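(* Let $(X,d)$ be the haircomb space with its arc-length measure $\mu$ and let $w=f_h$ be the weight on it, both as defined in the context. Then $w$ is not a doubling weight. Explicitly, there exists a sequence of balls $B_j$ in $X$ such that $w(2B_j)\ge 4$ for all $j$, but $w(B_j)\to 0$ as $j\to\infty$.
   Context: Equip $\mathbb{R}^2$ with the $\ell^\infty$ metric $d$. Set $A=\{(u,0):u\in\mathbb{R}\}$, $U=\{(u,\tfrac12u):u\in(0,1]\}$, $V=\{(1,v):v\in[\tfrac12,1]\}$. For $j\in\mathbb{N}$ let $U_j=U+(10j,0)$, $V_j=V+(10j,0)$, $W_j=U_j\cup V_j$. The haircomb space is $X=A\cup\bigcup_{j\in\mathbb{N}}W_j\subset\mathbb{R}^2$ with the restriction of the $\ell^\infty$ metric $d$ and the arc-length measure $\mu$. Fix $0<\alpha<1$ and a sequence $0<\varepsilon_j\le1$ with $\varepsilon_j\to0$. Let $h(t)=t^{-\alpha}\left(\log(e/t)\right)^{-1}$ for $t\in(0,1]$ and $g(t)=\max\{h(t),1\}$. The weight $w=f_h:X\to[0,\infty)$ is defined by $w(x)=1$ if $x\in A$; $w(x)=\varepsilon_j$ if $x\in V_j$; and $w(x)=\min\{1,\varepsilon_jg(u)\}$ if $x=(10j+u,\tfrac12u)\in U_j$. For a ball $B=B(x,r)=\{y\in X:d(x,y)<r\}$, $2B=B(x,2r)$. For a measurable set $E$, $w(E)=\int_Ew\,d\mu$. The weight $w$ is doubling if there is a constant $C$ with $w(2B)\le Cw(B)$ for all balls $B$. *)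

theory Defs
  imports "HOL-Analysis.Analysis"
begin

section \<open>The haircomb space\<close>

definition linf_dist :: "real \<times> real \<Rightarrow> real \<times> real \<Rightarrow> real" where
  "linf_dist p q = max \<bar>fst p - fst q\<bar> \<bar>snd p - snd q\<bar>"

definition comb_A :: "(real \<times> real) set" where
  "comb_A = {(u, 0) | u. True}"

definition comb_U :: "nat \<Rightarrow> (real \<times> real) set" where
  "comb_U j = (\<lambda>p. p + (10 * real j, 0)) ` {(u, u / 2) | u. 0 < u \<and> u \<le> 1}"

definition comb_V :: "nat \<Rightarrow> (real \<times> real) set" where
  "comb_V j = (\<lambda>p. p + (10 * real j, 0)) ` {(1, v) | v. 1 / 2 \<le> v \<and> v \<le> 1}"

definition comb_W :: "nat \<Rightarrow> (real \<times> real) set" where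
  "comb_W j = comb_U j \<union> comb_V j"

definition haircomb :: "(real \<times> real) set" where
  "haircomb = comb_A \<union> (\<Union>j. comb_W j)"

interpretation haircomb: Metric_space haircomb linf_dist
  by unfold_locales (auto simp: linf_dist_def prod_eq_iff)

section \<open>Arc length\<close>

text \<open>
  Arc length is taken with respect to the metric \<^const>\<open>linf_dist\<close>.  Each of the three kinds of
  arc has an obvious parametrization that is an isometric embedding of an interval, hence a
  parametrization by arc length; in particular \<open>u \<mapsto> (10 j + u, u / 2)\<close> has unit speed
  (in the Euclidean metric its speed would be \<open>sqrt 5 / 2\<close>).  The arc-length measure is the sum
  of the push-forwards of Lebesgue measure along these parametrizations.
\<close>

definition param_A :: "real \<Rightarrow> real \<times> real" where
  "param_A u = (u, 0)"

definition param_U :: "nat \<Rightarrow> real \<Rightarrow> real \<times> real" where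
  "param_U j u = (10 * real j + u, u / 2)"

definition param_V :: "nat \<Rightarrow> real \<Rightarrow> real \<times> real" where
  "param_V j v = (10 * real j + 1, v)"

definition arc_length :: "(real \<times> real) set \<Rightarrow> ennreal" where
  "arc_length E = emeasure lborel (param_A -` E) +
     (\<Sum>j. emeasure lborel ({0<..1} \<inter> param_U j -` E) +
           emeasure lborel ({1/2..1} \<inter> param_V j -` E))"

definition haircomb_measure :: "(real \<times> real) measure" where
  "haircomb_measure = measure_of haircomb (sets (restrict_space borel haircomb)) arc_length"

lemma mem_comb_A: "(x, y) \<in> comb_A \<longleftrightarrow> y = 0"
  by (auto simp: comb_A_def)

lemma mem_comb_U:
  "(x, y) \<in> comb_U j \<longleftrightarrow> 10 * real j < x \<and> x \<le> 10 * real j + 1 \<and> y = (x - 10 * real j) / 2"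
  by (auto simp: comb_U_def intro!: image_eqI[where x = "(x - 10 * real j, y)"])

lemma mem_comb_V:
  "(x, y) \<in> comb_V j \<longleftrightarrow> x = 10 * real j + 1 \<and> 1 / 2 \<le> y \<and> y \<le> 1"
  by (auto simp: comb_V_def intro!: image_eqI[where x = "(x - 10 * real j, y)"])

lemma param_images:
  "comb_A = range param_A" "comb_U j = param_U j ` {0<..1}" "comb_V j = param_V j ` {1/2..1}"
proof -
  show "comb_A = range param_A"
    by (auto simp: comb_A_def param_A_def)
  show "comb_U j = param_U j ` {0<..1}"
    by (auto simp: mem_comb_U param_U_def intro!: image_eqI[where x = "_ - 10 * real j"])
  show "comb_V j = param_V j ` {1/2..1}"
    by (auto simp: mem_comb_V param_V_def)
qed

lemma param_isometric:
  "linf_dist (param_A s) (param_A t) = \<bar>s - t\<bar>"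
  "linf_dist (param_U j s) (param_U j t) = \<bar>s - t\<bar>"
  "linf_dist (param_V j s) (param_V j t) = \<bar>s - t\<bar>"
  by (auto simp: linf_dist_def param_A_def param_U_def param_V_def)

lemma param_measurable [measurable]:
  "param_A \<in> borel_measurable borel" "param_U j \<in> borel_measurable borel"
  "param_V j \<in> borel_measurable borel"
  unfolding param_A_def param_U_def param_V_def
  by (intro borel_measurable_Pair; simp)+

lemma comb_disjoint:
  "comb_A \<inter> comb_W j = {}"
  "i \<noteq> j \<Longrightarrow> comb_W i \<inter> comb_W j = {}"
  "comb_U j \<inter> comb_V j = {(10 * real j + 1, 1 / 2)}"
proof -
  show "comb_A \<inter> comb_W j = {}" 
    by (auto simp: comb_W_def mem_comb_A mem_comb_U mem_comb_V)
  show "comb_U j \<inter> comb_V j = {(10 * real j + 1, 1 / 2)}"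
    by (auto simp: mem_comb_U mem_comb_V)
  have *: "\<lfloor>fst p / 10\<rfloor> = int k" if "p \<in> comb_W k" for p k
    using that by (auto simp: comb_W_def comb_U_def comb_V_def floor_eq_iff)
  show "i \<noteq> j \<Longrightarrow> comb_W i \<inter> comb_W j = {}"
    using *[of _ i] *[of _ j] by (metis disjoint_iff of_nat_eq_iff)
qed

lemma sets_haircomb_measure:
  "sets haircomb_measure = sets (restrict_space borel haircomb)"
  "space haircomb_measure = haircomb"
proof -
  have s: "space (restrict_space borel haircomb) = haircomb"
    by (simp add: space_restrict_space)
  show "sets haircomb_measure = sets (restrict_space borel haircomb)"
    unfolding haircomb_measure_def
    using sets.sets_measure_of_eq[of "restrict_space borel haircomb"] s by simp
  show "space haircomb_measure = haircomb"
    unfolding haircomb_measure_def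
    using sets.space_measure_of_eq[of "restrict_space borel haircomb"] s by simp
qed

lemma emeasure_haircomb_measure:
  assumes "E \<in> sets (restrict_space borel haircomb)"
  shows "emeasure haircomb_measure E = arc_length E"
proof (rule emeasure_measure_of[OF haircomb_measure_def])
  show "sets (restrict_space borel haircomb) \<subseteq> Pow haircomb"
    using sets.sets_into_space[of _ "restrict_space borel haircomb"]
    by (auto simp: space_restrict_space)
  show "E \<in> sets haircomb_measure"
    using assms by (simp add: sets_haircomb_measure)
  show "positive (sets haircomb_measure) arc_length"
    by (simp add: positive_def arc_length_def)
  have ad: "(\<Sum>i. emeasure lborel (I \<inter> \<gamma> -` F i)) = emeasure lborel (I \<inter> \<gamma> -` (\<Union>i. F i))"
    if F: "range F \<subseteq> sets haircomb_measure" "disjoint_family F"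
      and g: "\<gamma> \<in> borel_measurable borel" "I \<in> sets borel" "\<gamma> ` I \<subseteq> haircomb"
    for F :: "nat \<Rightarrow> _" and I and \<gamma> :: "real \<Rightarrow> real \<times> real"
  proof -
    have m: "I \<inter> \<gamma> -` F i \<in> sets borel" for i
    proof -
      obtain B where B: "B \<in> sets borel" "F i = haircomb \<inter> B"
      proof -
        have "F i \<in> (\<inter>) haircomb ` sets borel"
          using F(1) unfolding sets_haircomb_measure sets_restrict_space by blast
        then show ?thesis using that by blast
      qed
      have "I \<inter> \<gamma> -` F i = I \<inter> \<gamma> -` B"
        using g(3) B(2) by auto
      then show ?thesis
        using measurable_sets_borel[OF g(1) B(1)] g(2) by simp
    qed
    have "(\<Sum>i. emeasure lborel (I \<inter> \<gamma> -` F i)) = emeasure lborel (\<Union>i. I \<inter> \<gamma> -` F i)"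
    proof (rule suminf_emeasure)
      show "range (\<lambda>i. I \<inter> \<gamma> -` F i) \<subseteq> sets lborel"
        using m by auto
      show "disjoint_family (\<lambda>i. I \<inter> \<gamma> -` F i)"
        using F(2) unfolding disjoint_family_on_def by blast
    qed
    also have "(\<Union>i. I \<inter> \<gamma> -` F i) = I \<inter> \<gamma> -` (\<Union>i. F i)" by auto
    finally show ?thesis .
  qed
  show "countably_additive (sets haircomb_measure) arc_length"
  proof (rule countably_additiveI)
    fix F :: "nat \<Rightarrow> _"
    assume F: "range F \<subseteq> sets haircomb_measure" "disjoint_family F"
    let ?U = "\<lambda>j E. emeasure lborel ({0<..1} \<inter> param_U j -` E)"
    let ?V = "\<lambda>j E. emeasure lborel ({1/2..1} \<inter> param_V j -` E)"
    have a: "(\<Sum>i. emeasure lborel (param_A -` F i)) = emeasure lborel (param_A -` (\<Union>i. F i))"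
      using ad[OF F, of param_A UNIV] by (simp add: haircomb_def param_images)
    have u: "(\<Sum>i. ?U j (F i)) = ?U j (\<Union>i. F i)" for j
      by (rule ad[OF F]) (auto simp: haircomb_def param_images comb_W_def)
    have v: "(\<Sum>i. ?V j (F i)) = ?V j (\<Union>i. F i)" for j
      by (rule ad[OF F]) (auto simp: haircomb_def param_images comb_W_def)
    have swap: "(\<Sum>i. \<Sum>j. f i j) = (\<Sum>j. \<Sum>i. f i j)" for f :: "nat \<Rightarrow> nat \<Rightarrow> ennreal"
    proof -
      have "(\<Sum>i. \<Sum>j. f i j) = (\<Sum>i. \<integral>\<^sup>+ j. f i j \<partial>count_space UNIV)"
        by (simp only: nn_integral_count_space_nat)
      also have "\<dots> = (\<integral>\<^sup>+ j. (\<Sum>i. f i j) \<partial>count_space UNIV)"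
        by (rule nn_integral_suminf[symmetric]) simp
      also have "\<dots> = (\<Sum>j. \<Sum>i. f i j)"
        by (rule nn_integral_count_space_nat)
      finally show ?thesis .
    qed
    have "(\<Sum>i. \<Sum>j. ?U j (F i) + ?V j (F i)) = (\<Sum>j. \<Sum>i. ?U j (F i) + ?V j (F i))"
      by (rule swap)
    also have "\<dots> = (\<Sum>j. ?U j (\<Union>i. F i) + ?V j (\<Union>i. F i))"
      by (simp add: suminf_add[symmetric] u v)
    finally show "(\<Sum>i. arc_length (F i)) = arc_length (\<Union>i. F i)"
      by (simp add: arc_length_def suminf_add[symmetric] a)
  qed
qed

section \<open>Weights\<close>

definition weighted_measure :: "'a measure \<Rightarrow> ('a \<Rightarrow> real) \<Rightarrow> 'a set \<Rightarrow> ennreal" where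
  "weighted_measure M w E = (\<integral>\<^sup>+ x \<in> E. ennreal (w x) \<partial>M)"

text \<open>The centre and the radius of a ball are part of the datum: the ball \<open>2B\<close> depends on them.\<close>

definition doubling_weight ::
    "'a set \<Rightarrow> ('a \<Rightarrow> 'a \<Rightarrow> real) \<Rightarrow> 'a measure \<Rightarrow> ('a \<Rightarrow> real) \<Rightarrow> bool" where
  "doubling_weight X d M w \<longleftrightarrow>
     (\<exists>C::real. C \<ge> 0 \<and> (\<forall>x\<in>X. \<forall>r>0.
        weighted_measure M w (Metric_space.mball X d x (2 * r))
          \<le> ennreal C * weighted_measure M w (Metric_space.mball X d x r)))"

definition weight_h :: "real \<Rightarrow> real \<Rightarrow> real" where
  "weight_h \<alpha> t = t powr (- \<alpha>) * inverse (ln (exp 1 / t))"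

text \<open>
  In the last two branches \<open>p\<close> lies on exactly one hair, so the description is proper.  At the common
  point of \<open>comb_U j\<close> and \<open>comb_V j\<close> the two formulas agree when \<open>h 1 = 1\<close>.
\<close>

definition haircomb_weight :: "(real \<Rightarrow> real) \<Rightarrow> (nat \<Rightarrow> real) \<Rightarrow> real \<times> real \<Rightarrow> real" where
  "haircomb_weight h \<epsilon> p =
     (if p \<in> comb_A then 1
      else let j = (THE j. p \<in> comb_W j)
           in if p \<in> comb_V j then \<epsilon> j
              else min 1 (\<epsilon> j * max (h (fst p - 10 * real j)) 1))"

lemma haircomb_weight_A: "p \<in> comb_A \<Longrightarrow> haircomb_weight h \<epsilon> p = 1"
  by (simp add: haircomb_weight_def)

lemma the_hair: "p \<in> comb_W j \<Longrightarrow> (THE j. p \<in> comb_W j) = j"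
  using comb_disjoint(2) by blast

lemma haircomb_weight_V: "p \<in> comb_V j \<Longrightarrow> haircomb_weight h \<epsilon> p = \<epsilon> j"
  using comb_disjoint(1)[of j] the_hair[of p j]
  by (auto simp: haircomb_weight_def comb_W_def Let_def)

lemma haircomb_weight_U:
  assumes "0 < \<epsilon> j" "\<epsilon> j \<le> 1" "0 < u" "u \<le> 1"
  shows "haircomb_weight (weight_h \<alpha>) \<epsilon> (10 * real j + u, u / 2)
           = min 1 (\<epsilon> j * max (weight_h \<alpha> u) 1)"
proof -
  have p: "(10 * real j + u, u / 2) \<in> comb_U j"
    using assms by (simp add: mem_comb_U)
  show ?thesis
  proof (cases "u = 1")
    case True
    with p have "(10 * real j + u, u / 2) \<in> comb_V j"
      using comb_disjoint(3)[of j] by auto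
    with True show ?thesis
      using assms by (simp add: haircomb_weight_V weight_h_def)
  next
    case False
    with p have "(10 * real j + u, u / 2) \<notin> comb_V j"
      by (simp add: mem_comb_V)
    with p show ?thesis
      using comb_disjoint(1)[of j] the_hair[of "(10 * real j + u, u / 2)" j]
      by (auto simp: haircomb_weight_def comb_W_def Let_def)
  qed
qed

end

theory Submission
  imports Defs
begin

text \<open>
  Let \<open>B j\<close> be the ball of radius 1 about the tip \<open>(10 j + 1, 1)\<close> of the \<open>j\<close>-th hair.  The spine
  is at distance exactly 1 from the tip, so \<open>B j\<close> lies inside the \<open>j\<close>-th hair, where the weight is
  small; the ball of radius 2 contains a segment of the spine of length 4, where the weight is 1.

  The mass of \<open>B j\<close> tends to 0 because the singularity of the weight at the foot of a hair is
  integrable.  On the \<open>j\<close>-th hair the weight is at most 1 and, at height \<open>y\<close>, at most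
  \<open>\<epsilon> j * y powr (- \<alpha>)\<close> (lemma \<open>haircomb_weight_hair_le\<close>), and the part of the hair up to height
  \<open>\<delta>\<close> has length at most \<open>3 * \<delta>\<close> (lemma \<open>emeasure_lower_hair_le\<close>).  Cutting the hair
  at height \<open>\<epsilon> j\<close> and using the first bound below the cut and the second one above it gives
  \<open>w (B j) \<le> 3 * \<epsilon> j + 3 * \<epsilon> j powr (1 - \<alpha>)\<close>, and \<open>\<alpha> < 1\<close>.
\<close>

section \<open>Arc length of hairs and of the spine\<close>

lemma sets_borel_snd_le: "{p::real \<times> real. snd p \<le> c} \<in> sets borel"
  by (intro borel_closed closed_Collect_le continuous_intros)

lemma sets_borel_comb_W: "comb_W j \<in> sets borel"
proof -
  have U: "comb_U j = {p. 10 * real j < fst p} \<inter> {p. fst p \<le> 10 * real j + 1} \<inter>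
          {p. snd p = (fst p - 10 * real j) / 2}"
    by (auto simp: mem_comb_U)
  have V: "comb_V j = {p. fst p = 10 * real j + 1} \<inter> {p. 1 / 2 \<le> snd p} \<inter> {p. snd p \<le> 1}"
    by (auto simp: mem_comb_V)
  have "comb_U j \<in> sets borel"
    unfolding U
    by (intro sets.Int borel_open[OF open_Collect_less] borel_closed[OF closed_Collect_le]
          borel_closed[OF closed_Collect_eq] continuous_intros; simp)
  moreover have "comb_V j \<in> sets borel"
    unfolding V
    by (intro sets.Int borel_closed[OF closed_Collect_le] borel_closed[OF closed_Collect_eq]
          continuous_intros)
  ultimately show ?thesis
    unfolding comb_W_def by (rule sets.Un)
qed

lemma sets_haircomb_measureI:
  assumes "E \<in> sets borel" "E \<subseteq> haircomb"
  shows "E \<in> sets haircomb_measure"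
  using assms unfolding sets_haircomb_measure sets_restrict_space by (auto intro!: image_eqI[of _ _ E])

lemma emeasure_haircomb_measure_subset_hair:
  assumes "E \<in> sets borel" "E \<subseteq> comb_W j"
  shows "emeasure haircomb_measure E = emeasure lborel ({0<..1} \<inter> param_U j -` E) +
           emeasure lborel ({1/2..1} \<inter> param_V j -` E)"
proof -
  have "E \<subseteq> haircomb"
    using assms(2) by (auto simp: haircomb_def)
  then have "emeasure haircomb_measure E = arc_length E"
    using emeasure_haircomb_measure sets_haircomb_measureI[OF assms(1)]
    by (simp add: sets_haircomb_measure)
  moreover have "param_A -` E = {}"
    using assms(2) comb_disjoint(1)[of j] unfolding param_images by blast
  moreover have "(\<Sum>i. emeasure lborel ({0<..1} \<inter> param_U i -` E) +
           emeasure lborel ({1/2..1} \<inter> param_V i -` E)) =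
         emeasure lborel ({0<..1} \<inter> param_U j -` E) + emeasure lborel ({1/2..1} \<inter> param_V j -` E)"
  proof -
    have "{0<..1} \<inter> param_U i -` E = {}" "{1/2..1} \<inter> param_V i -` E = {}" if "i \<noteq> j" for i
      using assms(2) comb_disjoint(2)[OF that] unfolding param_images comb_W_def by blast+
    then show ?thesis
      by (subst suminf_finite[where N = "{j}"]) auto
  qed
  ultimately show ?thesis
    by (simp add: arc_length_def)
qed

text \<open>
  Height grows at rate \<open>1/2\<close> along the slanted part and at rate 1 along the vertical part, so
  the two parts contribute at most \<open>2 * \<delta>\<close> and \<open>\<delta>\<close>.  Since no hair is higher than 1, the case
  \<open>\<delta> = 1\<close> also bounds the length of the whole hair.
\<close>

lemma emeasure_lower_hair_le:
  assumes "0 \<le> \<delta>"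
  shows "emeasure haircomb_measure (comb_W j \<inter> {p. snd p \<le> \<delta>}) \<le> ennreal (3 * \<delta>)"
proof -
  let ?E = "comb_W j \<inter> {p. snd p \<le> \<delta>}"
  have "emeasure haircomb_measure ?E = emeasure lborel ({0<..1} \<inter> param_U j -` ?E) +
           emeasure lborel ({1/2..1} \<inter> param_V j -` ?E)"
    by (rule emeasure_haircomb_measure_subset_hair) (auto intro: sets_borel_comb_W sets_borel_snd_le)
  also have "\<dots> \<le> emeasure lborel {0..2 * \<delta>} + emeasure lborel {0..\<delta>}"
    by (intro add_mono emeasure_mono) (auto simp: param_U_def param_V_def)
  also have "\<dots> = ennreal (3 * \<delta>)"
    using assms by (simp add: ennreal_plus[symmetric] del: ennreal_plus)
  finally show ?thesis .
qed

lemma emeasure_hair_le: "emeasure haircomb_measure (comb_W j) \<le> 3"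
proof -
  have "comb_W j \<inter> {p. snd p \<le> 1} = comb_W j"
    by (auto simp: comb_W_def mem_comb_U mem_comb_V)
  then show ?thesis
    using emeasure_lower_hair_le[of 1 j] by simp
qed

lemma emeasure_spine_segment:
  assumes "a \<le> b"
  shows "param_A ` {a<..<b} \<in> sets haircomb_measure"
    and "emeasure haircomb_measure (param_A ` {a<..<b}) = ennreal (b - a)"
proof -
  let ?E = "param_A ` {a<..<b}"
  have "?E = {p. a < fst p} \<inter> {p. fst p < b} \<inter> {p. snd p = 0}"
    by (auto simp: param_A_def)
  moreover have "{p::real \<times> real. a < fst p} \<in> sets borel" "{p::real \<times> real. fst p < b} \<in> sets borel"
    by (intro borel_open open_Collect_less continuous_intros)+
  moreover have "{p::real \<times> real. snd p = 0} \<in> sets borel"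
    by (intro borel_closed closed_Collect_eq continuous_intros)
  ultimately have "?E \<in> sets borel"
    by (metis sets.Int)
  moreover have sub: "?E \<subseteq> comb_A"
    by (auto simp: param_images)
  ultimately show s: "?E \<in> sets haircomb_measure"
    by (intro sets_haircomb_measureI) (auto simp: haircomb_def)
  have "{0<..1} \<inter> param_U j -` ?E = {}" "{1/2..1} \<inter> param_V j -` ?E = {}" for j
    using sub comb_disjoint(1)[of j] unfolding param_images comb_W_def by blast+
  moreover have "param_A -` ?E = {a<..<b}"
    by (auto simp: param_A_def)
  ultimately show "emeasure haircomb_measure ?E = ennreal (b - a)"
    using s assms by (simp add: emeasure_haircomb_measure sets_haircomb_measure arc_length_def)
qed

section \<open>The weight on a hair\<close>

text \<open>
  The logarithm in \<^const>\<open>weight_h\<close> can only help, because \<open>ln (exp 1 / u) = 1 - ln u \<ge> 1\<close>.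
\<close>

lemma weight_h_le_powr:
  assumes "0 < u" "u \<le> 1"
  shows "weight_h \<alpha> u \<le> u powr (- \<alpha>)"
proof -
  have "1 \<le> ln (exp 1 / u)"
    using assms by (simp add: ln_div)
  then have "inverse (ln (exp 1 / u)) \<le> 1"
    by (simp add: inverse_le_1_iff)
  then show ?thesis
    unfolding weight_h_def by (intro mult_right_le_one_le) (use \<open>1 \<le> _\<close> in auto)
qed

text \<open>
  Measuring by height gives one bound for both parts of a hair: on the slanted part the parameter is
  twice the height, and on the vertical part \<open>snd p powr (- \<alpha>) \<ge> 1\<close>.
\<close>

lemma haircomb_weight_hair_le:
  assumes "p \<in> comb_W j" "0 < \<epsilon> j" "\<epsilon> j \<le> 1" "0 \<le> \<alpha>"
  shows "haircomb_weight (weight_h \<alpha>) \<epsilon> p \<le> 1"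
    and "haircomb_weight (weight_h \<alpha>) \<epsilon> p \<le> \<epsilon> j * snd p powr (- \<alpha>)"
proof -
  have ge_1: "1 \<le> y powr (- \<alpha>)" if "0 < y" "y \<le> 1" for y :: real
    using that assms(4) powr_mono2'[of "- \<alpha>" y 1] by simp
  consider (U) u where "0 < u" "u \<le> 1" "p = (10 * real j + u, u / 2)"
    | (V) "p \<in> comb_V j" "1 / 2 \<le> snd p" "snd p \<le> 1"
    using assms(1) by (fastforce simp: comb_W_def param_images param_U_def param_V_def)
  then have "haircomb_weight (weight_h \<alpha>) \<epsilon> p \<le> 1 \<and>
             haircomb_weight (weight_h \<alpha>) \<epsilon> p \<le> \<epsilon> j * snd p powr (- \<alpha>)"
  proof cases
    case U
    have "max (weight_h \<alpha> u) 1 \<le> u powr (- \<alpha>)"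
      using weight_h_le_powr[OF U(1,2)] ge_1[OF U(1,2)] by simp
    also have "\<dots> \<le> (u / 2) powr (- \<alpha>)"
      using U(1) assms(4) by (intro powr_mono2') auto
    finally have "\<epsilon> j * max (weight_h \<alpha> u) 1 \<le> \<epsilon> j * (u / 2) powr (- \<alpha>)"
      using assms(2) by (intro mult_left_mono) auto
    then show ?thesis
      using U haircomb_weight_U[of \<epsilon> j u \<alpha>] assms(2,3) by (auto intro: min.coboundedI2)
  next
    case V
    then show ?thesis
      using assms(2,3) ge_1[of "snd p"] by (simp add: haircomb_weight_V)
  qed
  then show "haircomb_weight (weight_h \<alpha>) \<epsilon> p \<le> 1"
    and "haircomb_weight (weight_h \<alpha>) \<epsilon> p \<le> \<epsilon> j * snd p powr (- \<alpha>)"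
    by auto
qed

lemma weighted_measure_subset_hair_le:
  assumes "B \<subseteq> comb_W j" "0 < \<epsilon> j" "\<epsilon> j \<le> 1" "0 \<le> \<alpha>"
  shows "weighted_measure haircomb_measure (haircomb_weight (weight_h \<alpha>) \<epsilon>) B
           \<le> ennreal (3 * \<epsilon> j + 3 * \<epsilon> j powr (1 - \<alpha>))"
proof -
  define w where "w = haircomb_weight (weight_h \<alpha>) \<epsilon>"
  define c where "c = \<epsilon> j powr (1 - \<alpha>)"
  \<comment> \<open>Cutting at height \<open>\<epsilon> j\<close> works since \<open>\<epsilon> j * \<epsilon> j powr (- \<alpha>) = c\<close> still tends to 0.\<close>
  let ?L = "comb_W j \<inter> {p. snd p \<le> \<epsilon> j}"
  have sets: "comb_W j \<in> sets haircomb_measure" "?L \<in> sets haircomb_measure"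
    using sets_borel_comb_W[of j] sets_borel_snd_le[of "\<epsilon> j"]
    by (auto intro!: sets_haircomb_measureI simp: haircomb_def)
  have c: "c = \<epsilon> j * \<epsilon> j powr (- \<alpha>)"
    using assms(2) powr_add[of "\<epsilon> j" 1 "- \<alpha>"] by (simp add: c_def)
  have w_le: "ennreal (w p) \<le> indicator ?L p + ennreal c * indicator (comb_W j) p"
    if p: "p \<in> comb_W j" for p
  proof (cases "snd p \<le> \<epsilon> j")
    case True
    have "ennreal (w p) \<le> 1"
      using haircomb_weight_hair_le(1)[of p j \<epsilon> \<alpha>] p assms by (simp add: w_def)
    then show ?thesis
      using True p by (simp add: add_increasing2)
  next
    case False
    then have "w p \<le> \<epsilon> j * snd p powr (- \<alpha>)"
      using haircomb_weight_hair_le(2)[of p j \<epsilon> \<alpha>] p assms by (simp add: w_def)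
    also have "\<dots> \<le> c"
      unfolding c using False assms by (intro mult_left_mono powr_mono2') auto
    finally show ?thesis
      using False p by (simp add: ennreal_leI)
  qed
  have "weighted_measure haircomb_measure w B
      \<le> (\<integral>\<^sup>+ p. (indicator ?L p + ennreal c * indicator (comb_W j) p) \<partial>haircomb_measure)"
    unfolding weighted_measure_def
  proof (rule nn_integral_mono)
    fix p
    show "ennreal (w p) * indicator B p \<le> indicator ?L p + ennreal c * indicator (comb_W j) p"
      using w_le[of p] assms(1) by (cases "p \<in> B") auto
  qed
  also have "\<dots> = emeasure haircomb_measure ?L + ennreal c * emeasure haircomb_measure (comb_W j)"
    using sets by (simp add: nn_integral_add nn_integral_cmult)
  also have "\<dots> \<le> ennreal (3 * \<epsilon> j) + ennreal c * 3"
    using assms(2) by (intro add_mono mult_left_mono emeasure_lower_hair_le emeasure_hair_le) auto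
  also have "\<dots> = ennreal (3 * \<epsilon> j + 3 * c)"
    using assms(2) by (simp add: c_def ennreal_plus ennreal_mult mult.commute)
  finally show ?thesis
    by (simp add: w_def c_def)
qed

section \<open>Balls about the tips of the hairs\<close>

lemma tip_in_haircomb: "(10 * real j + 1, 1) \<in> haircomb"
  by (auto simp: haircomb_def comb_W_def mem_comb_V)

lemma mball_tip_subset_hair: "haircomb.mball (10 * real j + 1, 1) 1 \<subseteq> comb_W j"
proof
  fix p assume "p \<in> haircomb.mball (10 * real j + 1, 1) 1"
  then have p: "p \<in> haircomb" and d: "\<bar>10 * real j + 1 - fst p\<bar> < 1" "\<bar>1 - snd p\<bar> < 1"
    by (auto simp: linf_dist_def)
  have "p \<notin> comb_A"
    using d(2) by (auto simp: comb_A_def)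
  then obtain i where i: "p \<in> comb_W i"
    using p by (auto simp: haircomb_def)
  then have "10 * real i < fst p" "fst p \<le> 10 * real i + 1"
    by (auto simp: comb_W_def comb_U_def comb_V_def)
  then have "real i < real j + 1" "real j < real i + 1"
    using d(1) by linarith+
  then have "i = j"
    by linarith
  with i show "p \<in> comb_W j"
    by simp
qed

lemma weighted_measure_double_ball_tip_ge:
  "4 \<le> weighted_measure haircomb_measure (haircomb_weight h \<epsilon>)
         (haircomb.mball (10 * real j + 1, 1) 2)"
proof -
  let ?S = "param_A ` {10 * real j - 1<..<10 * real j + 3}"
  have A: "?S \<subseteq> comb_A"
    by (auto simp: param_images)
  then have "?S \<subseteq> haircomb"
    by (auto simp: haircomb_def)
  moreover have "linf_dist (10 * real j + 1, 1) (param_A u) < 2"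
    if "u \<in> {10 * real j - 1<..<10 * real j + 3}" for u
  proof -
    have "\<bar>10 * real j + 1 - u\<bar> < 2"
      using that by (simp add: abs_less_iff)
    then show ?thesis
      by (simp add: linf_dist_def param_A_def)
  qed
  ultimately have B: "?S \<subseteq> haircomb.mball (10 * real j + 1, 1) 2"
    using tip_in_haircomb[of j] unfolding haircomb.mball_def by blast
  have "4 = emeasure haircomb_measure ?S"
    by (simp add: emeasure_spine_segment)
  also have "\<dots> = (\<integral>\<^sup>+ p. indicator ?S p \<partial>haircomb_measure)"
    by (simp add: emeasure_spine_segment(1))
  also have "\<dots> \<le> weighted_measure haircomb_measure (haircomb_weight h \<epsilon>)
                     (haircomb.mball (10 * real j + 1, 1) 2)"
    unfolding weighted_measure_def
    by (rule nn_integral_mono) (use A B in \<open>auto simp: haircomb_weight_A split: split_indicator\<close>)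
  finally show ?thesis .
qed

theorem theorem5p1:
  fixes \<alpha> :: real and \<epsilon> :: "nat \<Rightarrow> real" and w :: "real \<times> real \<Rightarrow> real"
  assumes "0 < \<alpha>" and "\<alpha> < 1"
    and "\<And>j. 0 < \<epsilon> j" and "\<And>j. \<epsilon> j \<le> 1" and "\<epsilon> \<longlonglongrightarrow> 0"
    and "w = haircomb_weight (weight_h \<alpha>) \<epsilon>"
  shows "\<not> doubling_weight haircomb linf_dist haircomb_measure w \<and>
    (\<exists>(x :: nat \<Rightarrow> real \<times> real) (r :: nat \<Rightarrow> real).
       (\<forall>j. x j \<in> haircomb \<and> 0 < r j) \<and>
       (\<forall>j. 4 \<le> weighted_measure haircomb_measure w (haircomb.mball (x j) (2 * r j))) \<and>
       (\<lambda>j. weighted_measure haircomb_measure w (haircomb.mball (x j) (r j))) \<longlonglongrightarrow> 0)"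
proof -
  let ?tip = "\<lambda>j. (10 * real j + 1, 1::real)"
  let ?m = "\<lambda>j r. weighted_measure haircomb_measure w (haircomb.mball (?tip j) r)"
  have large: "4 \<le> ?m j 2" for j
    unfolding assms(6) by (rule weighted_measure_double_ball_tip_ge)
  have "(\<lambda>j. 3 * \<epsilon> j + 3 * \<epsilon> j powr (1 - \<alpha>)) \<longlonglongrightarrow> 3 * 0 + 3 * 0"
    using assms(2,3)
    by (intro tendsto_intros assms(5) tendsto_zero_powrI[OF assms(5) tendsto_const])
      (auto simp: less_imp_le)
  then have "(\<lambda>j. ennreal (3 * \<epsilon> j + 3 * \<epsilon> j powr (1 - \<alpha>))) \<longlonglongrightarrow> 0"
    using tendsto_ennrealI by fastforce
  moreover have "?m j 1 \<le> ennreal (3 * \<epsilon> j + 3 * \<epsilon> j powr (1 - \<alpha>))" for j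
    unfolding assms(6)
    by (rule weighted_measure_subset_hair_le[OF mball_tip_subset_hair assms(3,4) less_imp_le[OF assms(1)]])
  ultimately have small: "(\<lambda>j. ?m j 1) \<longlonglongrightarrow> 0"
    by (intro tendsto_sandwich[where f = "\<lambda>_. 0" and g = "\<lambda>j. ?m j 1"
          and h = "\<lambda>j. ennreal (3 * \<epsilon> j + 3 * \<epsilon> j powr (1 - \<alpha>))"] always_eventually tendsto_const)
      (simp_all del: ennreal_plus)
  have "\<not> doubling_weight haircomb linf_dist haircomb_measure w"
  proof
    assume "doubling_weight haircomb linf_dist haircomb_measure w"
    then obtain C where "\<And>x r. x \<in> haircomb \<Longrightarrow> 0 < r \<Longrightarrow>
        weighted_measure haircomb_measure w (haircomb.mball x (2 * r))
          \<le> ennreal C * weighted_measure haircomb_measure w (haircomb.mball x r)"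
      unfolding doubling_weight_def by blast
    from this[OF tip_in_haircomb, of 1] have "?m j 2 \<le> ennreal C * ?m j 1" for j
      by simp
    then have "4 \<le> ennreal C * ?m j 1" for j
      using large order_trans by blast
    moreover have "(\<lambda>j. ennreal C * ?m j 1) \<longlonglongrightarrow> ennreal C * 0"
      by (intro ennreal_tendsto_cmult small) simp
    ultimately have "(4::ennreal) \<le> ennreal C * 0"
      by (intro LIMSEQ_le_const) auto
    then show False
      by simp
  qed
  then show ?thesis
    using tip_in_haircomb large small by (intro conjI exI[of _ ?tip] exI[of _ "\<lambda>_. 1"]) auto
qed

end
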